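(* Let $G$ be a connected TB graph on $n\geq 3$ vertices with Randić matrix $R$. Then $$RE(G)\leq \sqrt{n-2}\,\sqrt{n-3}\,\frac{\sqrt{2}}{2}+2.$$ Moreover, if $\operatorname{null}(R)\geq 1$, then $$RE(G)\leq (n-3)\frac{\sqrt{2}}{2}+2.$$
   Context: Graphs are finite, simple and undirected. For a graph $G$ with vertex set $V$, edge set $E$ and vertex degrees $d_u$, the Randić matrix $R=[r_{uv}]$ is the real symmetric matrix indexed by $V$ with $r_{uv}=1/\sqrt{d_ud_v}$ if $uv\in E$ and $r_{uv}=0$ otherwise. The Randić energy is $RE(G)=\sum_{i=1}^n|\lambda_i|$, where $\lambda_1,\dots,\lambda_n$ are the eigenvalues of $R$ with multiplicity. $\operatorname{null}(R)$ denotes the dimension of the null space of $R$. A TB graph is a bipartite graph with a bipartition $V=A\cup B$ such that $\deg(b)\leq 2$ for every $b\in B$. *)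

theory Defs
  imports
    "Graph_Theory.Graph_Theory"
    "Jordan_Normal_Form.Matrix_Kernel"
    "Jordan_Normal_Form.Char_Poly"
begin

text \<open>
  A finite simple undirected graph is a \<^locale>\<open>pair_graph\<close>: an undirected edge \<open>uv\<close> is
  represented by the two arcs \<open>(u, v)\<close> and \<open>(v, u)\<close>, so the degree of a vertex is its out-degree.
\<close>

abbreviation degree_of :: "'v pair_pre_digraph \<Rightarrow> 'v \<Rightarrow> nat" where
  "degree_of G v \<equiv> out_degree (with_proj G) v"

definition TB_graph :: "'v pair_pre_digraph \<Rightarrow> bool" where
  "TB_graph G \<longleftrightarrow>
    (\<exists>A B. A \<union> B = pverts G \<and> A \<inter> B = {} \<and>
      (\<forall>(u, v) \<in> parcs G. (u \<in> A \<and> v \<in> B) \<or> (u \<in> B \<and> v \<in> A)) \<and>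
      (\<forall>b \<in> B. degree_of G b \<le> 2))"

definition randic_entry :: "'v pair_pre_digraph \<Rightarrow> 'v \<Rightarrow> 'v \<Rightarrow> real" where
  "randic_entry G u v =
    (if (u, v) \<in> parcs G then 1 / sqrt (real (degree_of G u) * real (degree_of G v)) else 0)"

text \<open>
  Matrices of type \<^typ>\<open>real mat\<close> have rows and columns numbered from \<open>0\<close>. The list \<open>vs\<close> is
  an enumeration of the vertices that numbers them; it is meant to satisfy
  \<^term>\<open>distinct vs\<close> and \<^term>\<open>set vs = pverts G\<close>.
\<close>

definition randic_matrix :: "'v pair_pre_digraph \<Rightarrow> 'v list \<Rightarrow> real mat" where
  "randic_matrix G vs =
    mat (length vs) (length vs) (\<lambda>(i, j). randic_entry G (vs ! i) (vs ! j))"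

text \<open>
  The eigenvalues with multiplicity are the real roots of the characteristic polynomial, with
  their multiplicities. For a symmetric matrix no eigenvalue is missed by this, as
  \<open>size_eigenvalues_mset_symmetric\<close> below shows.
\<close>

definition eigenvalues_mset :: "real mat \<Rightarrow> real multiset" where
  "eigenvalues_mset A = proots (char_poly A)"

definition randic_energy :: "'v pair_pre_digraph \<Rightarrow> 'v list \<Rightarrow> real" where
  "randic_energy G vs = (\<Sum>x \<in># eigenvalues_mset (randic_matrix G vs). \<bar>x\<bar>)"

lemma randic_matrix_carrier: "randic_matrix G vs \<in> carrier_mat (length vs) (length vs)"
  by (simp add: randic_matrix_def)

lemma randic_matrix_symmetric:
  assumes "pair_graph G"
  shows "transpose_mat (randic_matrix G vs) = randic_matrix G vs"
proof -
  interpret pair_graph G by fact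
  have "(u, v) \<in> parcs G \<longleftrightarrow> (v, u) \<in> parcs G" for u v
    using pair_sym_arcs by (auto simp: symmetric_def sym_def)
  then show ?thesis
    by (intro eq_matI) (auto simp: randic_matrix_def randic_entry_def mult.commute)
qed

lemma symmetric_eigenvalue_real:
  fixes A :: "real mat"
  assumes A: "A \<in> carrier_mat n n" and sym: "transpose_mat A = A"
    and ev: "eigenvalue (map_mat complex_of_real A) k"
  shows "k \<in> \<real>"
proof -
  let ?C = "map_mat complex_of_real A"
  have C: "?C \<in> carrier_mat n n" using A by simp
  obtain v where v: "v \<in> carrier_vec n" "v \<noteq> 0\<^sub>v n" and Cv: "?C *\<^sub>v v = k \<cdot>\<^sub>v v"
    using ev A unfolding eigenvalue_def eigenvector_def by auto
  have entry: "A $$ (i, j) = A $$ (j, i)" if "i < n" "j < n" for i j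
    using that A sym by (metis carrier_matD index_transpose_mat(1))
  have mv: "(?C *\<^sub>v v) $ i = (\<Sum>j<n. complex_of_real (A $$ (i, j)) * v $ j)" if "i < n" for i
    using that A v by (auto simp: scalar_prod_def atLeast0LessThan intro!: sum.cong)
  have comp: "(\<Sum>j<n. complex_of_real (A $$ (i, j)) * v $ j) = k * v $ i" if "i < n" for i
    using mv[OF that] Cv v that by simp
  define N where "N = (\<Sum>i<n. v $ i * cnj (v $ i))"
  have "k * N = (\<Sum>i<n. (k * v $ i) * cnj (v $ i))"
    by (simp add: N_def sum_distrib_left mult.assoc)
  also have "\<dots> = (\<Sum>i<n. \<Sum>j<n. complex_of_real (A $$ (i, j)) * v $ j * cnj (v $ i))"
    by (intro sum.cong refl) (simp add: comp[symmetric] sum_distrib_right)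
  also have "\<dots> = (\<Sum>j<n. \<Sum>i<n. complex_of_real (A $$ (i, j)) * v $ j * cnj (v $ i))"
    by (rule sum.swap)
  also have "\<dots> = (\<Sum>j<n. v $ j * cnj (\<Sum>i<n. complex_of_real (A $$ (j, i)) * v $ i))"
    by (intro sum.cong refl) (auto simp: sum_distrib_left entry mult_ac intro!: sum.cong)
  also have "\<dots> = (\<Sum>j<n. v $ j * cnj (k * v $ j))"
    by (intro sum.cong refl) (simp add: comp)
  also have "\<dots> = cnj k * N"
    by (simp add: N_def sum_distrib_left mult_ac)
  finally have eq: "k * N = cnj k * N" .
  have "N \<noteq> 0"
  proof
    assume "N = 0"
    moreover have "N = complex_of_real (\<Sum>i<n. (cmod (v $ i))\<^sup>2)"
      by (simp add: N_def complex_norm_square[symmetric])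
    ultimately have "(\<Sum>i<n. (cmod (v $ i))\<^sup>2) = 0" by (metis of_real_eq_0_iff)
    then have "\<forall>i<n. v $ i = 0" by (simp add: sum_nonneg_eq_0_iff)
    with v show False by (metis eq_vecI carrier_vecD index_zero_vec)
  qed
  with eq have "cnj k = k" by simp
  then show ?thesis by (simp add: Reals_cnj_iff)
qed

lemma size_eigenvalues_mset_symmetric:
  fixes A :: "real mat"
  assumes A: "A \<in> carrier_mat n n" and sym: "transpose_mat A = A"
  shows "size (eigenvalues_mset A) = n"
proof -
  let ?C = "map_mat complex_of_real A"
  have C: "?C \<in> carrier_mat n n" using A by simp
  obtain as where as: "char_poly ?C = (\<Prod>a\<leftarrow>as. [:- a, 1:])" "length as = n"
    using char_poly_factorized[OF C] by blast
  have "a \<in> \<real>" if "a \<in> set as" for a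
  proof -
    have "poly (char_poly ?C) a = 0"
      using that by (auto simp: as(1) poly_prod_list prod_list_zero_iff)
    then show ?thesis
      using symmetric_eigenvalue_real[OF A sym] eigenvalue_root_char_poly[OF C] by blast
  qed
  then have "as = map (complex_of_real \<circ> Re) as"
    by (intro map_idI[symmetric]) auto
  then obtain rs where rs: "as = map complex_of_real rs"
    by (metis map_map)
  interpret P: map_poly_inj_idom_hom complex_of_real ..
  have "map_poly complex_of_real (char_poly A) = char_poly ?C"
    using of_real_hom.char_poly_hom[OF A, where 'a = complex] by simp
  also have "\<dots> = map_poly complex_of_real (\<Prod>a\<leftarrow>rs. [:- a, 1:])"
    by (simp add: as(1) rs P.hom_prod_list o_def)
  finally have "char_poly A = (\<Prod>a\<leftarrow>rs. [:- a, 1:])"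
    by (simp add: poly_eq_iff coeff_map_poly)
  moreover have "proots (\<Prod>a\<leftarrow>rs. [:- a, 1:]) = (\<Sum>a\<leftarrow>rs. proots [:- a, 1:])"
    using proots_prod_list[of "map (\<lambda>a. [:- a, 1:]) rs"] by (simp add: o_def image_iff)
  moreover have "(\<Sum>a\<leftarrow>rs. proots [:- a, 1:]) = mset rs"
    by (induction rs) simp_all
  ultimately have "eigenvalues_mset A = mset rs"
    by (simp only: eigenvalues_mset_def)
  then show ?thesis using as(2) rs by simp
qed

end

theory Submission
  imports Defs "Jordan_Normal_Form.Schur_Decomposition"
begin

text \<open>
  Let \<open>R\<close> be the Randic matrix and \<open>m\<close> the number of edges. The numbers \<open>1\<close> and \<open>-1\<close> are
  eigenvalues of \<open>R\<close>: the vector \<open>u \<mapsto> sqrt d\<^sub>u\<close> is fixed by \<open>R\<close>, and changing its sign on one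
  side of the bipartition gives an eigenvector for \<open>-1\<close> (\<open>eigenvalue_randic_matrix\<close>). They
  contribute the summand \<open>2\<close> of the bounds. By Cauchy-Schwarz, the other \<open>n - 2\<close> eigenvalues
  contribute at most \<open>sqrt ((n - 2) (tr (R\<^sup>2) - 2))\<close>; if \<open>R\<close> is singular, one of them is \<open>0\<close>, and
  the factor \<open>n - 2\<close> improves to \<open>n - 3\<close>. Hence both bounds follow from the single estimate
  \<open>tr (R\<^sup>2) \<le> (n + 1) / 2\<close>.

  To see this estimate, consider an edge \<open>uv\<close>. One of its ends lies in the part of the
  bipartition with degrees at most \<open>2\<close>. Not both ends have degree \<open>1\<close>, since then \<open>uv\<close> would be
  a whole component, whereas \<open>n \<ge> 3\<close>. So one end has degree at most \<open>2\<close> and the other at least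
  \<open>2\<close>, and therefore
  \<open>(1 - 2 / d\<^sub>u) (1 - 2 / d\<^sub>v) \<le> 0\<close>.
  Expand the product and sum over all \<open>2 m\<close> arcs. The terms \<open>1 / d\<^sub>u\<close> sum to \<open>n\<close>, as do the terms
  \<open>1 / d\<^sub>v\<close>, and the terms \<open>1 / (d\<^sub>u d\<^sub>v)\<close> sum to \<open>tr (R\<^sup>2)\<close>; so \<open>2 m - 4 n + 4 tr (R\<^sup>2) \<le> 0\<close>. As
  \<open>G\<close> is connected, \<open>m \<ge> n - 1\<close>, and the estimate follows (\<open>connected_TB_sum_squares_le\<close>).
\<close>

section \<open>Eigenvalues of real symmetric matrices\<close>

lemma proots_linear_factors:
  fixes es :: "'a :: idom list"
  shows "proots (\<Prod>a\<leftarrow>es. [:- a, 1:]) = mset es"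
proof (induction es)
  case (Cons a es)
  have "(\<Prod>a\<leftarrow>es. [:- a, 1:]) \<noteq> 0"
    by (auto simp: prod_list_zero_iff)
  then show ?case using Cons by (simp add: proots_mult del: mult_pCons_left)
qed simp

lemma monic_splits_if_size_proots:
  fixes p :: "'a :: field poly"
  assumes "lead_coeff p = 1" and "size (proots p) = degree p"
  shows "\<exists>es. p = (\<Prod>a\<leftarrow>es. [:- a, 1:])"
  using assms
proof (induction "degree p" arbitrary: p)
  case 0
  then have "p = 1" by (metis degree_0_id of_nat_1 of_nat_poly pCons_one)
  then show ?case by (intro exI[of _ "[]"]) simp
next
  case (Suc k)
  have p0: "p \<noteq> 0" using Suc.prems by auto
  have "proots p \<noteq> {#}" using Suc by auto
  then obtain x where "x \<in># proots p" by (meson multiset_nonemptyE)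
  then have "poly p x = 0" using p0 by simp
  then obtain q where q: "p = [:- x, 1:] * q"
    by (metis dvdE poly_eq_0_iff_dvd)
  have q0: "q \<noteq> 0" using q p0 by auto
  have dp: "degree p = Suc (degree q)" unfolding q using q0 by (subst degree_mult_eq) auto
  have "lead_coeff q = 1" using Suc.prems(1) unfolding q lead_coeff_mult by simp
  moreover have "size (proots q) = degree q"
    using Suc.prems(2) dp q0 unfolding q
    by (subst (asm) proots_mult) (auto simp del: mult_pCons_left)
  ultimately obtain es where "q = (\<Prod>a\<leftarrow>es. [:- a, 1:])"
    using Suc.hyps(1)[of q] Suc.hyps(2) dp by auto
  then show ?case using q by (intro exI[of _ "x # es"]) simp
qed

lemma trace_mult_comm:
  fixes A B :: "'a :: comm_semiring_0 mat"
  assumes "A \<in> carrier_mat n m" "B \<in> carrier_mat m n"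
  shows "(\<Sum>i<n. (A * B) $$ (i, i)) = (\<Sum>j<m. (B * A) $$ (j, j))"
proof -
  have "(\<Sum>i<n. (A * B) $$ (i, i)) = (\<Sum>i<n. \<Sum>j<m. A $$ (i, j) * B $$ (j, i))"
    using assms by (intro sum.cong) (auto simp: scalar_prod_def atLeast0LessThan)
  also have "\<dots> = (\<Sum>j<m. \<Sum>i<n. A $$ (i, j) * B $$ (j, i))"
    by (rule sum.swap)
  also have "\<dots> = (\<Sum>j<m. (B * A) $$ (j, j))"
    using assms by (intro sum.cong) (auto simp: scalar_prod_def atLeast0LessThan mult.commute)
  finally show ?thesis .
qed

text \<open>
  In \<open>(B B)\<^sub>i\<^sub>i = (\<Sum>j. B\<^sub>i\<^sub>j B\<^sub>j\<^sub>i)\<close> every term with \<open>j \<noteq> i\<close> has a factor below the diagonal.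
\<close>

lemma trace_square_upper_triangular:
  fixes B :: "'a :: comm_ring_1 mat"
  assumes B: "B \<in> carrier_mat n n" and ut: "upper_triangular B"
  shows "(\<Sum>i<n. (B * B) $$ (i, i)) = (\<Sum>x\<in>#mset (diag_mat B). x\<^sup>2)"
proof -
  have "(B * B) $$ (i, i) = (B $$ (i, i))\<^sup>2" if i: "i < n" for i
  proof -
    have "B $$ (i, j) * B $$ (j, i) = (if j = i then (B $$ (i, i))\<^sup>2 else 0)" if "j < n" for j
    proof (cases i j rule: linorder_cases)
      case less
      then have "B $$ (j, i) = 0" using upper_triangularD[OF ut, of i j] that B by auto
      then show ?thesis using less by simp
    next
      case greater
      then have "B $$ (i, j) = 0" using upper_triangularD[OF ut, of j i] i B by auto
      then show ?thesis using greater by simp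
    qed (simp add: power2_eq_square)
    then have "(\<Sum>j<n. B $$ (i, j) * B $$ (j, i)) = (\<Sum>j<n. if j = i then (B $$ (i, i))\<^sup>2 else 0)"
      by (intro sum.cong) auto
    then show ?thesis
      using i B by (simp add: scalar_prod_def atLeast0LessThan)
  qed
  then have "(\<Sum>i<n. (B * B) $$ (i, i)) = (\<Sum>i<n. (B $$ (i, i))\<^sup>2)"
    by simp
  also have "\<dots> = (\<Sum>x\<leftarrow>diag_mat B. x\<^sup>2)"
    using B by (simp add: diag_mat_def o_def sum_list_distinct_conv_sum_set atLeast0LessThan)
  also have "\<dots> = (\<Sum>x\<in>#mset (diag_mat B). x\<^sup>2)"
    by (metis mset_map sum_mset_sum_list)
  finally show ?thesis .
qed

text \<open>
  Both sides equal \<open>tr (A\<^sup>2)\<close>. All eigenvalues being real, \<open>A\<close> is similar over the reals to an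
  upper triangular matrix \<open>B\<close> that has the eigenvalues on its diagonal, and \<open>A\<^sup>2\<close> is then similar
  to \<open>B\<^sup>2\<close>. On the other hand, symmetry turns \<open>(A A)\<^sub>i\<^sub>i\<close> into the sum of squares of row \<open>i\<close>.
\<close>

lemma sum_squares_eigenvalues_symmetric:
  fixes A :: "real mat"
  assumes A: "A \<in> carrier_mat n n" and sym: "transpose_mat A = A"
  shows "(\<Sum>x\<in>#eigenvalues_mset A. x\<^sup>2) = (\<Sum>i<n. \<Sum>j<n. (A $$ (i, j))\<^sup>2)"
proof -
  have deg: "degree (char_poly A) = n" and monic: "lead_coeff (char_poly A) = 1"
    using degree_monic_char_poly[OF A] by auto
  obtain es where es: "char_poly A = (\<Prod>a\<leftarrow>es. [:- a, 1:])"
    using monic_splits_if_size_proots[OF monic] size_eigenvalues_mset_symmetric[OF A sym] deg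
    by (auto simp: eigenvalues_mset_def)
  obtain B where B: "B \<in> carrier_mat n n" and ut: "upper_triangular B" and sim: "similar_mat A B"
    using schur_decomposition_exists[OF A es] by blast
  obtain P Q where wit: "similar_mat_wit A B P Q" using sim by (auto simp: similar_mat_def)
  note PQ = similar_mat_witD2[OF A wit]
  have ev: "eigenvalues_mset A = mset (diag_mat B)"
    unfolding eigenvalues_mset_def char_poly_similar[OF sim] char_poly_upper_triangular[OF B ut]
    by (rule proots_linear_factors)
  have "A * A = P * (B * (Q * P) * B * Q)"
    using PQ(4-7) unfolding PQ(3) by (simp add: assoc_mult_mat[of _ n n _ n _ n])
  also have "\<dots> = P * (B * B * Q)" using PQ by simp
  finally have AA: "A * A = P * (B * B * Q)" .
  have "(\<Sum>i<n. (A * A) $$ (i, i)) = (\<Sum>i<n. (B * B * Q * P) $$ (i, i))"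
    unfolding AA by (rule trace_mult_comm) (use PQ in auto)
  also have "B * B * Q * P = B * B" using PQ by (simp add: assoc_mult_mat[of _ n n _ n _ n])
  finally have tr: "(\<Sum>i<n. (A * A) $$ (i, i)) = (\<Sum>x\<in>#eigenvalues_mset A. x\<^sup>2)"
    using trace_square_upper_triangular[OF B ut] ev by simp
  have entry: "A $$ (i, j) = A $$ (j, i)" if "i < n" "j < n" for i j
    using that A sym by (metis carrier_matD index_transpose_mat(1))
  have "(A * A) $$ (i, i) = (\<Sum>j<n. (A $$ (i, j))\<^sup>2)" if "i < n" for i
    using A that
    by (auto simp: scalar_prod_def atLeast0LessThan power2_eq_square entry intro!: sum.cong)
  then show ?thesis using tr by simp
qed

text \<open>
  The dimension of the kernel depends on the matrix only through the kernel as a set. If \<open>0\<close> is not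
  an eigenvalue, this set is the kernel of the identity matrix.
\<close>

lemma eigenvalue_zero_if_kernel_dim:
  fixes A :: "'a :: field mat"
  assumes A: "A \<in> carrier_mat n n" and "kernel_dim A \<ge> 1"
  shows "eigenvalue A 0"
proof (rule ccontr)
  assume no: "\<not> eigenvalue A 0"
  have A0: "A *\<^sub>v 0\<^sub>v n = 0\<^sub>v n" using A by auto
  have "v = 0\<^sub>v n" if v: "v \<in> carrier_vec n" "A *\<^sub>v v = 0\<^sub>v n" for v
  proof (rule ccontr)
    assume "v \<noteq> 0\<^sub>v n"
    then have "eigenvector A v 0" using v A by (auto simp: eigenvector_def)
    then show False using no by (auto simp: eigenvalue_def)
  qed
  then have "{v \<in> carrier_vec n. A *\<^sub>v v = 0\<^sub>v n} = {0\<^sub>v n}"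
    using A0 by (intro equalityI subsetI) (blast, simp)
  moreover have "{v \<in> carrier_vec n. 1\<^sub>m n *\<^sub>v v = 0\<^sub>v n} = {0\<^sub>v n :: 'a vec}"
    by auto
  ultimately have "mat_kernel A = mat_kernel (1\<^sub>m n)"
    using mat_kernel[OF A] mat_kernel[of "1\<^sub>m n :: 'a mat" n n] by simp
  then have "kernel.dim n A = 0"
    by (simp add: kernel_one_mat)
  then show False using assms by (simp add: kernel_dim_def)
qed

lemma eigenvalue_in_eigenvalues_mset:
  fixes A :: "real mat"
  assumes A: "A \<in> carrier_mat n n" and "eigenvalue A k"
  shows "k \<in># eigenvalues_mset A"
proof -
  have "char_poly A \<noteq> 0" using degree_monic_char_poly[OF A] by auto
  then show ?thesis using assms eigenvalue_root_char_poly[OF A] by (simp add: eigenvalues_mset_def)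
qed

text \<open>
  This is the Cauchy-Schwarz inequality against the constant \<open>1\<close>. Over a multiset it is
  convenient to sum \<open>0 \<le> (t - \<bar>x\<bar>)\<^sup>2\<close>, with \<open>t\<close> the mean of the \<open>\<bar>x\<bar>\<close>.
\<close>

lemma sum_abs_mset_le_sqrt:
  fixes M :: "real multiset"
  shows "(\<Sum>x\<in>#M. \<bar>x\<bar>) \<le> sqrt (real (size M) * (\<Sum>x\<in>#M. x\<^sup>2))"
proof -
  define S Q where "S = (\<Sum>x\<in>#M. \<bar>x\<bar>)" and "Q = (\<Sum>x\<in>#M. x\<^sup>2)"
  have sq: "2 * t * (\<Sum>x\<in>#M. \<bar>x\<bar>) \<le> real (size M) * t\<^sup>2 + (\<Sum>x\<in>#M. x\<^sup>2)" for t
  proof (induction M)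
    case (add x M)
    have "2 * t * \<bar>x\<bar> \<le> t\<^sup>2 + x\<^sup>2"
      using zero_le_power2[of "t - \<bar>x\<bar>"] by (simp add: power2_diff)
    with add show ?case by (simp add: algebra_simps)
  qed simp
  show ?thesis
  proof (cases "M = {#}")
    case False
    then have k: "real (size M) > 0" by (simp add: nonempty_has_size)
    define t where "t = S / size M"
    have St: "S = size M * t" using k by (auto simp: t_def)
    have "2 * t * S \<le> size M * t\<^sup>2 + Q"
      using sq[of t] by (simp add: S_def Q_def)
    then have "size M * t\<^sup>2 \<le> Q"
      by (simp add: St power2_eq_square algebra_simps)
    then have "size M * (size M * t\<^sup>2) \<le> size M * Q"
      by (rule mult_left_mono) simp
    then have "S\<^sup>2 \<le> size M * Q"
      by (simp add: St power2_eq_square algebra_simps)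
    then show ?thesis unfolding S_def Q_def by (rule real_le_rsqrt)
  qed simp
qed

section \<open>Connected graphs\<close>

lemma (in pair_graph) connected_crossing_arc:
  assumes conn: "Digraph_Component.connected (with_proj G)"
    and S: "S \<subseteq> pverts G" "S \<noteq> {}" "S \<noteq> pverts G"
  shows "\<exists>u\<in>S. \<exists>v\<in>pverts G - S. (u, v) \<in> parcs G"
proof (rule ccontr)
  assume no: "\<not> ?thesis"
  obtain a b where a: "a \<in> S" and b: "b \<in> pverts G" "b \<notin> S" using S by blast
  have "strongly_connected (with_proj G)"
    using conn pair_sym_arcs by (intro symmetric_connected_imp_strongly_connected) auto
  then have "a \<rightarrow>\<^sup>*\<^bsub>with_proj G\<^esub> b"
    using a b S by (auto simp: strongly_connected_def)
  then have "b \<in> S"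
  proof (induction rule: reachable_induct)
    case (step x y)
    then have "(x, y) \<in> parcs G" by simp
    moreover from this have "y \<in> pverts G" using arc_snd_in_verts by fastforce
    ultimately show ?case using no step by blast
  qed (use a in simp)
  then show False using b by simp
qed

lemma (in pair_graph) parcs_sym: "(u, v) \<in> parcs G \<longleftrightarrow> (v, u) \<in> parcs G"
  using pair_sym_arcs by (auto simp: symmetric_def sym_def)

text \<open>
  Grow a set of vertices from a single vertex. Each new vertex is attached by an edge across the
  boundary of the set, and this edge provides two new arcs inside the set.
\<close>

lemma (in pair_graph) connected_card_arcs_ge:
  assumes conn: "Digraph_Component.connected (with_proj G)"
    and ne: "pverts G \<noteq> {}"
  shows "2 * (card (pverts G) - 1) \<le> card (parcs G)"
proof -
  have grow: "\<exists>S\<subseteq>pverts G. card S = Suc k \<and> 2 * k \<le> card (parcs G \<inter> S \<times> S)"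
    if "Suc k \<le> card (pverts G)" for k
    using that
  proof (induction k)
    case 0
    obtain v where "v \<in> pverts G" using ne by blast
    then show ?case by (intro exI[of _ "{v}"]) auto
  next
    case (Suc k)
    then obtain S where S: "S \<subseteq> pverts G" "card S = Suc k" "2 * k \<le> card (parcs G \<inter> S \<times> S)"
      by auto
    have "S \<noteq> pverts G" "S \<noteq> {}" using S Suc.prems by auto
    then obtain u v where uv: "u \<in> S" "v \<in> pverts G - S" "(u, v) \<in> parcs G"
      using connected_crossing_arc[OF conn S(1)] by blast
    let ?S = "insert v S"
    have finS: "finite S" using S pair_finite_verts finite_subset by blast
    have "u \<noteq> v" using uv by blast
    then have two: "card {(u, v), (v, u)} = 2" by simp
    have "2 * Suc k \<le> card (parcs G \<inter> S \<times> S) + 2"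
      using S(3) by simp
    also have "\<dots> = card (parcs G \<inter> S \<times> S \<union> {(u, v), (v, u)})"
      using uv pair_finite_arcs unfolding two[symmetric]
      by (intro card_Un_disjoint[symmetric]) blast+
    also have "\<dots> \<le> card (parcs G \<inter> ?S \<times> ?S)"
    proof (rule card_mono)
      show "finite (parcs G \<inter> ?S \<times> ?S)" using pair_finite_arcs by blast
      show "parcs G \<inter> S \<times> S \<union> {(u, v), (v, u)} \<subseteq> parcs G \<inter> ?S \<times> ?S"
        using uv parcs_sym[of u v] by blast
    qed
    finally have "2 * Suc k \<le> card (parcs G \<inter> ?S \<times> ?S)" .
    moreover have "card ?S = Suc (Suc k)" using finS uv S(2) by simp
    moreover have "?S \<subseteq> pverts G" using S(1) uv by blast
    ultimately show ?case by blast
  qed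
  have "card (pverts G) > 0" using ne pair_finite_verts by (simp add: card_gt_0_iff)
  then obtain S where S: "S \<subseteq> pverts G" "2 * (card (pverts G) - 1) \<le> card (parcs G \<inter> S \<times> S)"
    using grow[of "card (pverts G) - 1"] by auto
  note S(2)
  also have "card (parcs G \<inter> S \<times> S) \<le> card (parcs G)"
    using pair_finite_arcs by (intro card_mono) auto
  finally show ?thesis .
qed

lemma (in pair_graph) out_arcs_eq: "out_arcs (with_proj G) u = Pair u ` {v. (u, v) \<in> parcs G}"
  by (auto simp: out_arcs_def)

lemma (in pair_graph) degree_of_eq: "degree_of G u = card {v. (u, v) \<in> parcs G}"
  unfolding out_degree_def out_arcs_eq by (simp add: card_image inj_on_def)

lemma (in pair_graph) finite_neighbours: "finite {v. (u, v) \<in> parcs G}"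
  by (rule finite_subset[OF _ finite_imageI[OF pair_finite_arcs, of snd]]) force

lemma (in pair_graph) sum_arcs:
  "(\<Sum>(u, v)\<in>parcs G. f u v) = (\<Sum>u\<in>pverts G. \<Sum>v | (u, v) \<in> parcs G. f u v)"
proof -
  have "parcs G = (SIGMA u:pverts G. {v. (u, v) \<in> parcs G})"
    using arc_fst_in_verts by force
  then show ?thesis
    using sum.Sigma[of "pverts G" "\<lambda>u. {v. (u, v) \<in> parcs G}" f] pair_finite_verts
      finite_neighbours by simp
qed

lemma (in pair_graph) sum_arcs_swap:
  "(\<Sum>(u, v)\<in>parcs G. f u v) = (\<Sum>(u, v)\<in>parcs G. f v u)"
proof -
  have "bij_betw prod.swap (parcs G) (parcs G)"
    by (rule bij_betw_byWitness[where f' = prod.swap]) (use parcs_sym in auto)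
  from sum.reindex_bij_betw[OF this, of "\<lambda>(u, v). f u v"] show ?thesis
    by (simp add: case_prod_unfold)
qed

lemma (in pair_graph) connected_degree_pos:
  assumes "Digraph_Component.connected (with_proj G)" "card (pverts G) \<ge> 2" "u \<in> pverts G"
  shows "degree_of G u > 0"
proof -
  have "card {u} = 1" by simp
  then have "{u} \<noteq> pverts G" using assms(2) by (metis Suc_1 not_less_eq_eq One_nat_def le_refl)
  then obtain v where "(u, v) \<in> parcs G"
    using connected_crossing_arc[OF assms(1), of "{u}"] assms(3) by auto
  then show ?thesis using finite_neighbours by (auto simp: degree_of_eq card_gt_0_iff)
qed

text \<open>
  With a third vertex present, connectedness forces an arc to leave \<open>{u, v}\<close>; the end where it
  leaves has a second neighbour.
\<close>

lemma (in pair_graph) connected_arc_degrees_ge: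
  assumes conn: "Digraph_Component.connected (with_proj G)" and n: "card (pverts G) \<ge> 3"
    and uv: "(u, v) \<in> parcs G"
  shows "degree_of G u \<ge> 2 \<or> degree_of G v \<ge> 2"
proof -
  have V: "u \<in> pverts G" "v \<in> pverts G" "u \<noteq> v"
    using arc_fst_in_verts[OF uv] arc_snd_in_verts[OF uv] pair_no_loops[OF uv] by auto
  have "card {u, v} = 2" using V by simp
  then have "{u, v} \<noteq> pverts G" using n by auto
  then obtain x y where xy: "x \<in> {u, v}" "y \<notin> {u, v}" "(x, y) \<in> parcs G"
    using connected_crossing_arc[OF conn, of "{u, v}"] V by auto
  \<comment> \<open>the vertex of the edge \<open>uv\<close> opposite to \<open>x\<close>\<close>
  define z where "z = (if x = u then v else u)"
  have "{y, z} \<subseteq> {w. (x, w) \<in> parcs G}" "y \<noteq> z"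
    using xy uv parcs_sym[of u v] V by (auto simp: z_def)
  then have "degree_of G x \<ge> 2"
    using card_mono[OF finite_neighbours, of "{y, z}" x] by (simp add: degree_of_eq)
  moreover have "x = u \<or> x = v" using xy(1) by simp
  ultimately show ?thesis by (elim disjE) simp_all
qed

section \<open>The spectrum of the Randic matrix\<close>

text \<open>
  The eigenvector is \<open>u \<mapsto> \<sigma>\<^sub>u sqrt d\<^sub>u\<close>: each of the \<open>d\<^sub>u\<close> neighbours \<open>v\<close> of \<open>u\<close> contributes
  \<open>\<sigma>\<^sub>v sqrt d\<^sub>v / sqrt (d\<^sub>u d\<^sub>v) = c \<sigma>\<^sub>u / sqrt d\<^sub>u\<close> to the entry of its image at \<open>u\<close>. A constant \<open>\<sigma>\<close>
  gives the eigenvalue \<open>1\<close>, and the sign of a bipartition gives \<open>-1\<close>.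
\<close>

lemma (in pair_graph) eigenvalue_randic_matrix:
  fixes \<sigma> :: "'a \<Rightarrow> real"
  assumes vs: "distinct vs" "set vs = pverts G"
    and pos: "\<And>u. u \<in> pverts G \<Longrightarrow> degree_of G u > 0" and ne: "pverts G \<noteq> {}"
    and nz: "\<And>u. \<sigma> u \<noteq> 0"
    and arc: "\<And>u v. (u, v) \<in> parcs G \<Longrightarrow> \<sigma> v = c * \<sigma> u"
  shows "eigenvalue (randic_matrix G vs) c"
proof -
  let ?R = "randic_matrix G vs" and ?n = "length vs" and ?d = "degree_of G"
  define x where "x = vec ?n (\<lambda>i. \<sigma> (vs ! i) * sqrt (?d (vs ! i)))"
  have "(?R *\<^sub>v x) $ i = c * x $ i" if i: "i < ?n" for i
  proof -
    define u where "u = vs ! i"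
    have "u \<in> set vs" using i by (simp add: u_def)
    then have u: "u \<in> pverts G" using vs(2) by simp
    have sub: "{v. (u, v) \<in> parcs G} \<subseteq> pverts G" using arc_snd_in_verts by force
    have "(?R *\<^sub>v x) $ i = (\<Sum>j<?n. randic_entry G u (vs ! j) * (\<sigma> (vs ! j) * sqrt (?d (vs ! j))))"
      using i by (simp add: randic_matrix_def x_def scalar_prod_def atLeast0LessThan u_def)
    also have "\<dots> = (\<Sum>v\<in>pverts G. randic_entry G u v * (\<sigma> v * sqrt (?d v)))"
      by (rule sum.reindex_bij_betw) (use bij_betw_nth[OF vs(1)] vs in auto)
    also have "\<dots> = (\<Sum>v | (u, v) \<in> parcs G. randic_entry G u v * (\<sigma> v * sqrt (?d v)))"
      by (rule sum.mono_neutral_right) (use sub pair_finite_verts in \<open>auto simp: randic_entry_def\<close>)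
    also have "\<dots> = (\<Sum>v | (u, v) \<in> parcs G. c * \<sigma> u / sqrt (?d u))"
    proof (intro sum.cong refl)
      fix v assume "v \<in> {v. (u, v) \<in> parcs G}"
      then have v: "(u, v) \<in> parcs G" by simp
      then have "?d v > 0" using pos sub by auto
      then show "randic_entry G u v * (\<sigma> v * sqrt (?d v)) = c * \<sigma> u / sqrt (?d u)"
        using v arc[OF v] by (simp add: randic_entry_def real_sqrt_mult field_simps)
    qed
    also have "\<dots> = c * \<sigma> u * (?d u / sqrt (?d u))"
      by (simp add: degree_of_eq)
    also have "\<dots> = c * x $ i"
      using i by (simp add: x_def u_def real_div_sqrt)
    finally show ?thesis .
  qed
  then have "?R *\<^sub>v x = c \<cdot>\<^sub>v x"
    by (intro eq_vecI) (auto simp: randic_matrix_def x_def)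
  moreover have "x \<noteq> 0\<^sub>v ?n"
  proof -
    have 0: "0 < ?n" using ne vs by auto
    then have "vs ! 0 \<in> pverts G" using nth_mem[of 0 vs] vs(2) by simp
    then have "x $ 0 \<noteq> 0" using 0 nz[of "vs ! 0"] pos[of "vs ! 0"] by (simp add: x_def)
    then show ?thesis using 0 by auto
  qed
  ultimately show ?thesis
    unfolding eigenvalue_def eigenvector_def
    by (intro exI[of _ x]) (auto simp: randic_matrix_def x_def)
qed

lemma (in pair_graph) sum_squares_randic_matrix:
  assumes vs: "distinct vs" "set vs = pverts G"
  shows "(\<Sum>i<length vs. \<Sum>j<length vs. (randic_matrix G vs $$ (i, j))\<^sup>2)
    = (\<Sum>(u, v)\<in>parcs G. 1 / (real (degree_of G u) * real (degree_of G v)))"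
proof -
  have reindex: "(\<Sum>i<length vs. f (vs ! i)) = (\<Sum>v\<in>pverts G. f v)" for f :: "'a \<Rightarrow> real"
    by (rule sum.reindex_bij_betw) (use bij_betw_nth[OF vs(1)] vs in auto)
  have sub: "{v. (u, v) \<in> parcs G} \<subseteq> pverts G" for u using arc_snd_in_verts by force
  have "(\<Sum>i<length vs. \<Sum>j<length vs. (randic_matrix G vs $$ (i, j))\<^sup>2)
      = (\<Sum>u\<in>pverts G. \<Sum>v\<in>pverts G. (randic_entry G u v)\<^sup>2)"
    by (simp add: randic_matrix_def reindex[symmetric])
  also have "\<dots> = (\<Sum>u\<in>pverts G. \<Sum>v | (u, v) \<in> parcs G. (randic_entry G u v)\<^sup>2)"
    using sub pair_finite_verts
    by (intro sum.cong refl sum.mono_neutral_right) (auto simp: randic_entry_def)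
  also have "\<dots> = (\<Sum>(u, v)\<in>parcs G. 1 / (real (degree_of G u) * real (degree_of G v)))"
    unfolding sum_arcs by (intro sum.cong) (auto simp: randic_entry_def power_divide)
  finally show ?thesis .
qed

lemma (in pair_graph) sum_arcs_inverse_degree:
  assumes pos: "\<And>u. u \<in> pverts G \<Longrightarrow> degree_of G u > 0"
  shows "(\<Sum>(u, v)\<in>parcs G. 1 / real (degree_of G u)) = card (pverts G)"
proof -
  have "(\<Sum>v | (u, v) \<in> parcs G. 1 / real (degree_of G u)) = 1" if "u \<in> pverts G" for u
    using pos[OF that] by (simp add: degree_of_eq)
  then have "(\<Sum>u\<in>pverts G. \<Sum>v | (u, v) \<in> parcs G. 1 / real (degree_of G u)) = (\<Sum>u\<in>pverts G. 1)"
    by (intro sum.cong refl)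
  then show ?thesis unfolding sum_arcs by simp
qed

text \<open>
  The sum is the trace of the squared Randic matrix. The bound is the sum over all arcs of
  \<open>(1 - 2 / d\<^sub>u) (1 - 2 / d\<^sub>v) \<le> 0\<close>, combined with the number of arcs being at least \<open>2 (n - 1)\<close>. It
  is attained by every tree in which each vertex of one part has degree exactly \<open>2\<close>.
\<close>

lemma (in pair_graph) connected_TB_sum_squares_le:
  assumes conn: "Digraph_Component.connected (with_proj G)" and TB: "TB_graph G"
    and n: "card (pverts G) \<ge> 3"
  shows "(\<Sum>(u, v)\<in>parcs G. 1 / (real (degree_of G u) * real (degree_of G v)))
    \<le> (real (card (pverts G)) + 1) / 2"
proof -
  let ?d = "\<lambda>u. real (degree_of G u)" and ?n = "card (pverts G)"
  define T where "T = (\<Sum>(u, v)\<in>parcs G. 1 / (?d u * ?d v))"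
  have pos: "degree_of G u > 0" if "u \<in> pverts G" for u
    using connected_degree_pos[OF conn _ that] n by simp
  have arc: "(1 - 2 / ?d u) * (1 - 2 / ?d v) \<le> 0" if uv: "(u, v) \<in> parcs G" for u v
  proof -
    have d: "degree_of G u > 0" "degree_of G v > 0"
      using pos arc_fst_in_verts[OF uv] arc_snd_in_verts[OF uv] by auto
    have "degree_of G u \<le> 2 \<or> degree_of G v \<le> 2"
      using TB uv unfolding TB_graph_def by fast
    with connected_arc_degrees_ge[OF conn n uv]
    have "degree_of G u \<ge> 2 \<and> degree_of G v \<le> 2 \<or> degree_of G u \<le> 2 \<and> degree_of G v \<ge> 2"
      by linarith
    moreover have "2 / ?d w \<le> 1" if "degree_of G w \<ge> 2" for w
      using that by simp
    moreover have "2 / ?d w \<ge> 1" if "degree_of G w > 0" "degree_of G w \<le> 2" for w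
      using that by simp
    ultimately show ?thesis using d unfolding mult_le_0_iff by fastforce
  qed
  have "(\<Sum>(u, v)\<in>parcs G. (1 - 2 / ?d u) * (1 - 2 / ?d v)) \<le> 0"
    using arc by (intro sum_nonpos) auto
  also have "(\<Sum>(u, v)\<in>parcs G. (1 - 2 / ?d u) * (1 - 2 / ?d v))
    = (\<Sum>(u, v)\<in>parcs G. 1 - 2 * (1 / ?d u) - 2 * (1 / ?d v) + 4 * (1 / (?d u * ?d v)))"
    by (intro sum.cong) (auto simp: algebra_simps)
  also have "\<dots> = card (parcs G) - 2 * (\<Sum>(u, v)\<in>parcs G. 1 / ?d u)
      - 2 * (\<Sum>(u, v)\<in>parcs G. 1 / ?d v) + 4 * T"
    by (simp add: T_def case_prod_unfold sum.distrib sum_subtractf sum_distrib_left)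
  also have "\<dots> = card (parcs G) - 4 * real ?n + 4 * T"
    using sum_arcs_inverse_degree[OF pos] sum_arcs_swap[of "\<lambda>u v. 1 / ?d v"] by simp
  finally have "4 * T \<le> 4 * real ?n - card (parcs G)" by simp
  moreover have "2 * (real ?n - 1) \<le> card (parcs G)"
    using n connected_card_arcs_ge[OF conn] by fastforce
  ultimately have "T \<le> (real ?n + 1) / 2" by argo
  then show ?thesis unfolding T_def .
qed

theorem theorem5p5:
  fixes G :: "'v pair_pre_digraph" and vs :: "'v list" and n :: nat
  assumes "pair_graph G"
    and "Digraph_Component.connected (with_proj G)"
    and "TB_graph G"
    and "n = card (pverts G)" and "n \<ge> 3"
    and "distinct vs" and "set vs = pverts G"
  shows "randic_energy G vs \<le> sqrt (real n - 2) * sqrt (real n - 3) * (sqrt 2 / 2) + 2 \<and>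
    (kernel_dim (randic_matrix G vs) \<ge> 1 \<longrightarrow>
      randic_energy G vs \<le> (real n - 3) * (sqrt 2 / 2) + 2)"
proof -
  interpret pair_graph G by fact
  let ?R = "randic_matrix G vs"
  note conn = assms(2) and n = assms(4,5) and vs = assms(6,7)
  have len: "length vs = n" using vs n by (metis distinct_card)
  have R: "?R \<in> carrier_mat n n" using randic_matrix_carrier[of G vs] len by simp
  have sym: "transpose_mat ?R = ?R" by (rule randic_matrix_symmetric) fact
  have ne: "pverts G \<noteq> {}" using n by auto
  have pos: "degree_of G u > 0" if "u \<in> pverts G" for u
    using connected_degree_pos[OF conn _ that] n by simp
  obtain A where A: "\<And>u v. (u, v) \<in> parcs G \<Longrightarrow> (u \<in> A) \<noteq> (v \<in> A)"
    using assms(3) unfolding TB_graph_def by (smt (verit) case_prodD disjoint_iff)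
  have "eigenvalue ?R 1"
    by (rule eigenvalue_randic_matrix[OF vs pos ne, of "\<lambda>_. 1"]) auto
  moreover have "eigenvalue ?R (- 1)"
    by (rule eigenvalue_randic_matrix[OF vs pos ne, of "\<lambda>v. if v \<in> A then 1 else - 1"])
      (use A in auto)
  \<comment> \<open>the two eigenvalues being distinct, they can be split off together\<close>
  ultimately have "{#1, - 1#} \<subseteq># eigenvalues_mset ?R"
    using eigenvalue_in_eigenvalues_mset[OF R] by (simp add: insert_subset_eq_iff in_diff_count)
  then obtain N where N: "eigenvalues_mset ?R = {#1, - 1#} + N"
    using mset_subset_eq_exists_conv by blast
  have energy: "randic_energy G vs = 2 + (\<Sum>x\<in>#N. \<bar>x\<bar>)"
    unfolding randic_energy_def N by simp
  have "size (eigenvalues_mset ?R) = n"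
    by (rule size_eigenvalues_mset_symmetric[OF R sym])
  then have size: "size N + 2 = n" unfolding N by simp
  have "2 + (\<Sum>x\<in>#N. x\<^sup>2) = (\<Sum>x\<in>#eigenvalues_mset ?R. x\<^sup>2)"
    unfolding N by simp
  also have "\<dots> \<le> (real n + 1) / 2"
    using connected_TB_sum_squares_le[OF conn assms(3)] n sum_squares_randic_matrix[OF vs]
      sum_squares_eigenvalues_symmetric[OF R sym] len by simp
  finally have sq: "(\<Sum>x\<in>#N. x\<^sup>2) \<le> (real n - 3) / 2" by (simp add: field_simps)
  have half: "sqrt 2 / 2 = sqrt (1 / 2)" by (simp add: real_sqrt_divide real_div_sqrt field_simps)
  have "(\<Sum>x\<in>#N. \<bar>x\<bar>) \<le> sqrt (real (size N) * (\<Sum>x\<in>#N. x\<^sup>2))"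
    by (rule sum_abs_mset_le_sqrt)
  also have "real (size N) = real n - 2" using size by linarith
  also have "sqrt ((real n - 2) * (\<Sum>x\<in>#N. x\<^sup>2)) \<le> sqrt ((real n - 2) * ((real n - 3) / 2))"
    using sq n by (intro real_sqrt_le_mono mult_left_mono) auto
  also have "(real n - 2) * ((real n - 3) / 2) = (real n - 2) * (real n - 3) * (1 / 2)"
    by simp
  also have "sqrt \<dots> = sqrt (real n - 2) * sqrt (real n - 3) * (sqrt 2 / 2)"
    by (simp only: half real_sqrt_mult)
  finally have first: "randic_energy G vs \<le> sqrt (real n - 2) * sqrt (real n - 3) * (sqrt 2 / 2) + 2"
    using energy by simp
  have "randic_energy G vs \<le> (real n - 3) * (sqrt 2 / 2) + 2" if ker: "kernel_dim ?R \<ge> 1"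
  proof -
    have "0 \<in># eigenvalues_mset ?R"
      by (rule eigenvalue_in_eigenvalues_mset[OF R eigenvalue_zero_if_kernel_dim[OF R ker]])
    then have "0 \<in># N" unfolding N by simp
    then obtain L where L: "N = add_mset 0 L" by (meson mset_add)
    have "(\<Sum>x\<in>#N. \<bar>x\<bar>) = (\<Sum>x\<in>#L. \<bar>x\<bar>)" unfolding L by simp
    also have "\<dots> \<le> sqrt (real (size L) * (\<Sum>x\<in>#L. x\<^sup>2))"
      by (rule sum_abs_mset_le_sqrt)
    also have "real (size L) = real n - 3" using size unfolding L by simp
    also have "sqrt ((real n - 3) * (\<Sum>x\<in>#L. x\<^sup>2)) \<le> sqrt ((real n - 3) * ((real n - 3) / 2))"
      using sq n unfolding L by (intro real_sqrt_le_mono mult_left_mono) auto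
    also have "(real n - 3) * ((real n - 3) / 2) = (real n - 3)\<^sup>2 * (1 / 2)"
      by (simp add: power2_eq_square)
    also have "sqrt \<dots> = (real n - 3) * (sqrt 2 / 2)"
      using n by (simp only: half real_sqrt_mult) simp
    finally show ?thesis using energy by simp
  qed
  with first show ?thesis by blast
qed

end
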